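(* Let $0<\lambda,\sigma<\infty$. Then the following assertions hold. (a) If $\lambda\le\sigma$, then there exists an analytic function $f$ in $\mathbb{D}$ such that $\lambda_M(f)=\lambda$, $\sigma_M(f)=\sigma$ and $\lambda_*(f)=\lambda_M(f)+1$. (b) If $\lambda<\sigma$, then there exists an analytic function $f$ in $\mathbb{D}$ such that $\lambda_M(f)=\lambda$, $\sigma_M(f)=\sigma$ and $\lambda_*(f)=\lambda_M(f)+\frac{\lambda_M(f)}{\sigma_M(f)}$.
   Context: $\mathbb{D}=\{z\in\mathbb{C}:|z|<1\}$, $M(r,f)=\max_{|z|=r}|f(z)|$, and $\log^+x=\max\{\log x,0\}$ (with $\log^+0=0$). For $f$ analytic in $\mathbb{D}$, $$\sigma_M(f)=\limsup_{r\to1^-}\frac{\log^+\log^+M(r,f)}{\log\frac1{1-r}},\qquad \lambda_M(f)=\liminf_{r\to1^-}\frac{\log^+\log^+M(r,f)}{\log\frac1{1-r}},$$ $$\lambda_*(f)=\liminf_{r\to1^-}\frac{\log^+K(r,f)}{\log\frac1{1-r}},\qquad K(r,f)=r\,(\log M(r,f))'_+,$$ where $(\cdot)'_+$ denotes the right derivative with respect to $r$. *)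

theory Defs
  imports "HOL-Complex_Analysis.Complex_Analysis"
begin

definition log_plus :: "real \<Rightarrow> real" where
  "log_plus x = (if x > 0 then max (ln x) 0 else 0)"

(* For f continuous on the circle of radius r, 0 <= r, the supremum is attained,
   so it is the maximum modulus M(r,f). *)
definition max_modulus :: "real \<Rightarrow> (complex \<Rightarrow> complex) \<Rightarrow> real" where
  "max_modulus r f = (SUP z\<in>sphere 0 r. cmod (f z))"

(* The orders are extended reals: the limits may be infinite. *)
definition sigma_M :: "(complex \<Rightarrow> complex) \<Rightarrow> ereal" where
  "sigma_M f = Limsup (at_left 1)
     (\<lambda>r. ereal (log_plus (log_plus (max_modulus r f)) / ln (1 / (1 - r))))"

definition lambda_M :: "(complex \<Rightarrow> complex) \<Rightarrow> ereal" where
  "lambda_M f = Liminf (at_left 1)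
     (\<lambda>r. ereal (log_plus (log_plus (max_modulus r f)) / ln (1 / (1 - r))))"

(* The derivative within at_right r is the right derivative.  It exists for 0 < r < 1 whenever
   f is analytic in the unit disc and not identically zero, since log M(r,f) is then a convex
   function of log r (Hadamard's three circles theorem). *)
definition K_growth :: "real \<Rightarrow> (complex \<Rightarrow> complex) \<Rightarrow> real" where
  "K_growth r f = r * vector_derivative (\<lambda>t. ln (max_modulus t f)) (at_right r)"

definition lambda_star :: "(complex \<Rightarrow> complex) \<Rightarrow> ereal" where
  "lambda_star f = Liminf (at_left 1)
     (\<lambda>r. ereal (log_plus (K_growth r f) / ln (1 / (1 - r))))"

end

theory Submission
  imports Defs "HOL-Real_Asymp.Real_Asymp"
begin

text \<open>If \<open>f = exp \<circ> g\<close> with \<open>Re (g z) \<le> g \<bar>z\<bar>\<close> then \<open>ln M(r, f) = g(r)\<close> and \<open>K(r, f) = r g'(r)\<close>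
  exactly.  Take \<open>g(z) = a (1 - z) powr (-\<lambda>) + (\<Sum>k. N\<^sub>k powr \<sigma> * exp (-N\<^sub>k (1 - z)))\<close> with
  \<open>N\<^sub>k = exp (q ^ k)\<close>, so that \<open>N\<^bsub>k+1\<^esub> = N\<^sub>k powr q\<close>.  With \<open>x = 1 / (1 - r)\<close>, the sum is of size
  \<open>N\<^sub>k powr \<sigma>\<close> from \<open>x = N\<^sub>k\<close> until \<open>x\<close> nearly reaches \<open>N\<^bsub>k+1\<^esub>\<close>, so its order is \<open>\<sigma>\<close> and its
  lower order \<open>\<sigma> / q\<close>; its derivative is a sum of the same kind with \<open>\<sigma> + 1\<close> in place of \<open>\<sigma>\<close>,
  of lower order \<open>(\<sigma> + 1) / q\<close>.  Part (b) is \<open>a = 0\<close>, \<open>q = \<sigma> / \<lambda>\<close>.  In part (a), \<open>a = 1\<close> and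
  \<open>q = \<sigma> / \<lambda> + 1\<close>: the first summand then determines both lower orders.\<close>

section \<open>Orders of growth in the unit disc\<close>

text \<open>The common form of all three orders: \<open>G\<close> is \<open>log_plus\<close> of the
  maximum modulus for \<open>lambda_M\<close> and \<open>sigma_M\<close>, and
  \<open>K_growth\<close> for \<open>lambda_star\<close>.\<close>

definition growth_ratio :: "(real \<Rightarrow> real) \<Rightarrow> real \<Rightarrow> ereal" where
  "growth_ratio G r = ereal (log_plus (G r) / ln (1 / (1 - r)))"

text \<open>Taking logarithms turns the factor \<open>c\<close> into
  \<open>ln c / ln (1 / (1 - r))\<close>, which vanishes as r tends to 1; constant factors thus do
  not affect the orders.\<close>

lemma growth_ratio_lower:
  assumes "0 < c" "0 < r" "r < 1" "c * (1 - r) powr (-e) \<le> G r"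
  shows "ereal (ln c / ln (1 / (1 - r)) + e) \<le> growth_ratio G r"
proof -
  have pos: "0 < c * (1 - r) powr (-e)" "0 < ln (1 / (1 - r))"
    using assms by auto
  have "ln c + e * ln (1 / (1 - r)) = ln (c * (1 - r) powr (-e))"
    using assms by (simp add: ln_mult ln_powr ln_div)
  also have "\<dots> \<le> ln (G r)"
    using assms(4) pos(1) by (intro ln_mono)
  also have "\<dots> \<le> log_plus (G r)"
    using assms(4) pos(1) less_le_trans[OF pos(1) assms(4)] by (simp add: log_plus_def)
  finally have "(ln c + e * ln (1 / (1 - r))) / ln (1 / (1 - r)) \<le> log_plus (G r) / ln (1 / (1 - r))"
    using pos(2) by (intro divide_right_mono) auto
  then show ?thesis
    using pos(2) by (simp add: growth_ratio_def add_divide_distrib)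
qed

lemma ereal_le_Liminf_growth_ratio:
  assumes "0 < c" and ev: "\<forall>\<^sub>F r in at_left 1. c * (1 - r) powr (-e) \<le> G r"
  shows "ereal e \<le> Liminf (at_left 1) (growth_ratio G)"
proof -
  have "((\<lambda>r. ln c / ln (1 / (1 - r)) + e) \<longlongrightarrow> e) (at_left 1)"
    by real_asymp
  then have "Liminf (at_left 1) (\<lambda>r. ereal (ln c / ln (1 / (1 - r)) + e)) = ereal e"
    by (intro lim_imp_Liminf) auto
  moreover have "Liminf (at_left 1) (\<lambda>r. ereal (ln c / ln (1 / (1 - r)) + e))
      \<le> Liminf (at_left 1) (growth_ratio G)"
  proof (rule Liminf_mono)
    show "\<forall>\<^sub>F r in at_left 1. ereal (ln c / ln (1 / (1 - r)) + e) \<le> growth_ratio G r"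
      using ev eventually_at_left_real[OF zero_less_one]
      by eventually_elim (use assms(1) in \<open>auto intro!: growth_ratio_lower\<close>)
  qed
  ultimately show ?thesis
    by simp
qed

text \<open>\<open>1 \<le> C\<close> and \<open>0 \<le> e\<close> make the right-hand side
  nonnegative, which covers the points where \<open>log_plus\<close> truncates to 0.\<close>

lemma growth_ratio_upper:
  assumes "1 \<le> C" "0 \<le> e" "0 < r" "r < 1" "G r \<le> C * (1 - r) powr (-e)"
  shows "growth_ratio G r \<le> ereal (ln C / ln (1 / (1 - r)) + e)"
proof -
  have pos: "0 < ln (1 / (1 - r))" "0 \<le> ln C"
    using assms by auto
  have "log_plus (G r) \<le> ln C + e * ln (1 / (1 - r))"
  proof (cases "0 < G r")
    case True
    have "ln (G r) \<le> ln (C * (1 - r) powr (-e))"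
      using True assms(5) by (intro ln_mono) auto
    also have "\<dots> = ln C + e * ln (1 / (1 - r))"
      using assms by (simp add: ln_mult ln_powr ln_div)
    finally show ?thesis
      using True pos assms by (simp add: log_plus_def)
  next
    case False
    then show ?thesis
      using pos assms by (simp add: log_plus_def)
  qed
  then show ?thesis
    using pos(1) by (simp add: growth_ratio_def field_simps)
qed

lemma growth_ratio_bound_less:
  assumes "e < y"
  shows "\<forall>\<^sub>F r in at_left 1. ereal (ln C / ln (1 / (1 - r)) + e) < ereal y"
proof -
  have "((\<lambda>r. ln C / ln (1 / (1 - r)) + e) \<longlongrightarrow> e) (at_left 1)"
    by real_asymp
  from order_tendstoD(2)[OF this assms] show ?thesis
    by simp
qed

text \<open>A bound for each exponent above \<open>e\<close>, with its own constant, leaves room for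
  the small loss in the exponent that summing a lacunary series costs.\<close>

lemma Limsup_growth_ratio_le:
  assumes "0 \<le> e"
    and up: "\<And>e'. e < e' \<Longrightarrow> \<exists>C\<ge>1. \<forall>\<^sub>F r in at_left 1. G r \<le> C * (1 - r) powr (-e')"
  shows "Limsup (at_left 1) (growth_ratio G) \<le> ereal e"
  unfolding Limsup_le_iff
proof (intro allI impI)
  fix y assume "ereal e < y"
  then obtain y' where y': "e < y'" "ereal y' < y"
    using ereal_dense2 by force
  \<comment> \<open>The midpoint leaves a gap below \<open>y'\<close> that absorbs the vanishing
    term coming from \<open>C\<close>.\<close>
  define e' where "e' = (e + y') / 2"
  have e': "e < e'" "e' < y'" "0 \<le> e'"
    using y' assms(1) by (auto simp: e'_def)
  obtain C where C: "C \<ge> 1" "\<forall>\<^sub>F r in at_left 1. G r \<le> C * (1 - r) powr (-e')"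
    using up[OF e'(1)] by auto
  show "\<forall>\<^sub>F r in at_left 1. growth_ratio G r < y"
    using C(2) growth_ratio_bound_less[OF e'(2), of C] eventually_at_left_real[OF zero_less_one]
  proof eventually_elim
    case (elim r)
    have "growth_ratio G r \<le> ereal (ln C / ln (1 / (1 - r)) + e')"
      using elim C(1) e'(3) by (intro growth_ratio_upper) auto
    also have "\<dots> < ereal y'" by (fact elim(2))
    also have "\<dots> < y" by (fact y'(2))
    finally show ?case .
  qed
qed

text \<open>If the lower limit exceeded \<open>e\<close>, the bound with an exponent in between
  would fail for all r near 1. So it need only hold along a sequence tending to 1.\<close>

lemma Liminf_growth_ratio_le:
  assumes "0 \<le> e"
    and up: "\<And>e'. e < e' \<Longrightarrow> \<exists>C\<ge>1. \<exists>\<^sub>F r in at_left 1. G r \<le> C * (1 - r) powr (-e')"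
  shows "Liminf (at_left 1) (growth_ratio G) \<le> ereal e"
proof (rule ccontr)
  assume "\<not> ?thesis"
  then obtain y where y: "e < y" "ereal y < Liminf (at_left 1) (growth_ratio G)"
    using ereal_dense2 by (force simp: not_le)
  define e' where "e' = (e + y) / 2"
  have e': "e < e'" "e' < y" "0 \<le> e'"
    using y assms(1) by (auto simp: e'_def)
  obtain C where C: "C \<ge> 1" "\<exists>\<^sub>F r in at_left 1. G r \<le> C * (1 - r) powr (-e')"
    using up[OF e'(1)] by auto
  have "\<forall>\<^sub>F r in at_left 1. \<not> G r \<le> C * (1 - r) powr (-e')"
    using less_LiminfD[OF y(2)] growth_ratio_bound_less[OF e'(2), of C]
      eventually_at_left_real[OF zero_less_one]
  proof eventually_elim
    case (elim r)
    show ?case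
      using growth_ratio_upper[of C e' r G] elim C(1) e'(3) by (auto simp: growth_ratio_def)
  qed
  with C(2) show False
    by (simp add: frequently_def)
qed

lemma ereal_le_Limsup_growth_ratio:
  assumes "0 < c" and freq: "\<exists>\<^sub>F r in at_left 1. c * (1 - r) powr (-e) \<le> G r"
  shows "ereal e \<le> Limsup (at_left 1) (growth_ratio G)"
proof (rule ccontr)
  assume "\<not> ?thesis"
  then obtain y where y: "y < e" "Limsup (at_left 1) (growth_ratio G) < ereal y"
    using ereal_dense2 by (force simp: not_le)
  have "((\<lambda>r. ln c / ln (1 / (1 - r)) + e) \<longlongrightarrow> e) (at_left 1)"
    by real_asymp
  from order_tendstoD(1)[OF this y(1)]
  have "\<forall>\<^sub>F r in at_left 1. \<not> c * (1 - r) powr (-e) \<le> G r"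
    using Limsup_lessD[OF y(2)] eventually_at_left_real[OF zero_less_one]
  proof eventually_elim
    case (elim r)
    show ?case
      using growth_ratio_lower[of c r e G] elim assms(1)
      by (auto simp: growth_ratio_def)
  qed
  with freq show False
    by (simp add: frequently_def)
qed

lemma frequently_seqI:
  assumes "filterlim X F sequentially" "\<And>n::nat. P (X n)"
  shows "\<exists>\<^sub>F r in F. P r"
  unfolding frequently_def
proof
  assume "\<forall>\<^sub>F r in F. \<not> P r"
  then have "\<forall>\<^sub>F n in sequentially. \<not> P (X n)"
    using assms(1) unfolding filterlim_iff by blast
  then show False
    using assms(2) by simp
qed

section \<open>Lacunary exponential sums\<close>

definition lac_node :: "real \<Rightarrow> nat \<Rightarrow> real" where
  "lac_node q k = exp (q ^ k)"

text \<open>The argument stands for 1 - z. The type is left open so that the same series serves for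
  the real estimates and for complex differentiation.\<close>

definition lac_term :: "real \<Rightarrow> real \<Rightarrow> nat \<Rightarrow> 'a::{real_normed_field,banach} \<Rightarrow> 'a" where
  "lac_term q p k w = of_real (lac_node q k powr p) * exp (- of_real (lac_node q k) * w)"

definition lac_sum :: "real \<Rightarrow> real \<Rightarrow> 'a::{real_normed_field,banach} \<Rightarrow> 'a" where
  "lac_sum q p w = (\<Sum>k. lac_term q p k w)"

lemma lac_node_powr: "lac_node q k powr a = exp (a * q ^ k)"
  by (simp add: lac_node_def powr_def)

lemma lac_node_Suc: "lac_node q (Suc k) = lac_node q k powr q"
  by (simp add: lac_node_powr) (simp add: lac_node_def)

lemma lac_node_pos: "0 < lac_node q k"
  by (simp add: lac_node_def)

lemma filterlim_lac_node:
  assumes "1 < q" shows "filterlim (lac_node q) at_top sequentially"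
  using assms unfolding lac_node_def by real_asymp

lemma filterlim_one_minus_lac_node_powr:
  assumes "1 < q" "0 < \<theta>"
  shows "filterlim (\<lambda>k. 1 - lac_node q k powr (-\<theta>)) (at_left 1) sequentially"
proof -
  have "((\<lambda>k. lac_node q k powr (-\<theta>)) \<longlongrightarrow> 0) sequentially"
    using assms by (intro tendsto_neg_powr filterlim_lac_node) auto
  then have "((\<lambda>k. 1 - lac_node q k powr (-\<theta>)) \<longlongrightarrow> 1 - 0) sequentially"
    by (intro tendsto_intros)
  then show ?thesis
    by (auto simp: filterlim_at lac_node_powr)
qed

text \<open>By Bernoulli's inequality \<open>q ^ k\<close> grows at least linearly in
  \<open>k\<close>, which gives a geometric majorant.\<close>

lemma summable_lac_node_powr:
  assumes "1 < q" "0 < e"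
  shows "summable (\<lambda>k. lac_node q k powr (-e))"
proof (rule summable_comparison_test)
  show "\<exists>N. \<forall>k\<ge>N. norm (lac_node q k powr (-e)) \<le> exp (-(e * (q - 1))) ^ k"
  proof (intro exI allI impI)
    fix k :: nat
    have "real k * (q - 1) \<le> q ^ k"
      using Bernoulli_inequality[of "q - 1" k] assms by simp
    then have "e * (real k * (q - 1)) \<le> e * q ^ k"
      using assms by (intro mult_left_mono) auto
    then have "exp (-e * q ^ k) \<le> exp (real k * (-(e * (q - 1))))"
      by (simp add: algebra_simps)
    then show "norm (lac_node q k powr (-e)) \<le> exp (-(e * (q - 1))) ^ k"
      by (simp only: lac_node_powr exp_of_nat_mult real_norm_def abs_exp_cancel)
  qed
  show "summable (\<lambda>k. exp (-(e * (q - 1))) ^ k)"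
    using assms by (intro summable_geometric) auto
qed

section \<open>Upper and lower bounds for the sum on the positive axis\<close>

lemma exp_minus_le_powr:
  fixes u m :: real
  assumes "0 < u" "0 < m"
  shows "exp (- u) \<le> m powr m * u powr (-m)"
proof -
  have "(u / m) powr m \<le> exp (u / m) powr m"
    using assms exp_ge_add_one_self[of "u / m"] by (intro powr_mono2) (linarith | simp)+
  also have "\<dots> = exp u"
    using assms by (simp add: powr_def)
  finally show ?thesis
    using assms by (simp add: powr_divide powr_minus exp_minus field_simps)
qed

lemma lac_term_nonneg: "0 \<le> lac_term q p k (t::real)"
  by (simp add: lac_term_def)

text \<open>The exponential is traded for a negative power of \<open>lac_node q k * t\<close>. The
  exponent \<open>m\<close> is free: any \<open>m > p\<close> makes the bound summable in
  \<open>k\<close>.\<close>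

lemma lac_term_le:
  fixes t :: real
  assumes "0 < t" "0 < m"
  shows "lac_term q p k t \<le> m powr m * t powr (-m) * lac_node q k powr (p - m)"
proof -
  let ?N = "lac_node q k"
  have "exp (- (?N * t)) \<le> m powr m * (?N * t) powr (-m)"
    using assms lac_node_pos[of q k] by (intro exp_minus_le_powr) auto
  then have "?N powr p * exp (- (?N * t)) \<le> ?N powr p * (m powr m * (?N * t) powr (-m))"
    by (intro mult_left_mono) auto
  also have "\<dots> = m powr m * t powr (-m) * (?N powr p * ?N powr (-m))"
    using assms lac_node_pos[of q k] by (simp add: powr_mult)
  also have "?N powr p * ?N powr (-m) = ?N powr (p - m)"
    by (simp flip: powr_add)
  finally show ?thesis
    by (simp add: lac_term_def)
qed

lemma summable_lac_term:
  fixes t :: real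
  assumes "1 < q" "0 < p" "0 < t"
  shows "summable (\<lambda>k. lac_term q p k t)"
proof (rule summable_comparison_test)
  have "lac_term q p k t \<le> ((p + 1) powr (p + 1) * t powr -(p + 1)) * lac_node q k powr -1" for k
    using lac_term_le[of t "p + 1" q p k] assms by simp
  then show "\<exists>N. \<forall>k\<ge>N. norm (lac_term q p k t)
      \<le> ((p + 1) powr (p + 1) * t powr -(p + 1)) * lac_node q k powr -1"
    by (simp add: lac_term_nonneg)
  show "summable (\<lambda>k. ((p + 1) powr (p + 1) * t powr -(p + 1)) * lac_node q k powr -1)"
    using assms by (intro summable_mult summable_lac_node_powr) auto
qed

lemma lac_term_le_lac_sum:
  fixes t :: real
  assumes "1 < q" "0 < p" "0 < t"
  shows "lac_term q p k t \<le> lac_sum q p t"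
  using sum_le_suminf[OF summable_lac_term[OF assms], of "{k}"] lac_term_nonneg
  by (simp add: lac_sum_def)

lemma lac_sum_pos:
  fixes t :: real
  assumes "1 < q" "0 < p" "0 < t"
  shows "0 < lac_sum q p t"
proof -
  have "0 < lac_term q p 0 t"
    by (simp add: lac_term_def lac_node_def)
  with lac_term_le_lac_sum[OF assms, of 0] show ?thesis by simp
qed

text \<open>The term of index \<open>k\<close> alone suffices: its exponential factor is at least
  \<open>exp (-1)\<close> there.\<close>

lemma lac_sum_at_node:
  assumes "1 < q" "0 < p" "0 < t" "t \<le> lac_node q k powr (-1)"
  shows "exp (-1) * lac_node q k powr p \<le> lac_sum q p t"
proof -
  have "lac_node q k * t \<le> 1"
    using assms lac_node_pos[of q k] by (simp add: powr_minus field_simps)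
  then have "exp (-1) * lac_node q k powr p \<le> lac_term q p k t"
    by (simp add: lac_term_def mult_le_cancel_left mult.commute[of "exp (-1)"])
  with lac_term_le_lac_sum[OF assms(1-3), of k] show ?thesis by simp
qed

text \<open>Let \<open>k\<close> be the first index whose node exceeds \<open>1 / t\<close>. The
  previous node is at most \<open>1 / t\<close>, so its term is of full size, and its power
  \<open>p\<close> equals the power \<open>p / q\<close> of node \<open>k\<close>.\<close>

lemma lac_sum_lower:
  assumes "1 < q" "0 < p" "0 < t" "t \<le> exp (-1)"
  shows "exp (-1) * t powr (-(p / q)) \<le> lac_sum q p t"
proof -
  have "\<forall>\<^sub>F k in sequentially. 1 / t < lac_node q k"
    using filterlim_lac_node[OF assms(1)] by (simp add: filterlim_at_top_dense)
  then have ex: "\<exists>k. 1 / t < lac_node q k"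
    using eventually_happens'[OF sequentially_bot] by blast
  define k where "k = (LEAST k. 1 / t < lac_node q k)"
  have k: "1 / t < lac_node q k"
    unfolding k_def using ex by (rule LeastI_ex)
  \<comment> \<open>Node 0 is \<open>exp 1\<close>, so it does not exceed \<open>1 / t\<close>, and
    \<open>k\<close> has a predecessor.\<close>
  have "t * exp 1 \<le> 1"
    using mult_right_mono[OF assms(4), of "exp 1"] by (simp flip: exp_add)
  then have "k \<noteq> 0"
    using k assms by (intro notI) (auto simp: lac_node_def field_simps)
  then obtain j where j: "k = Suc j"
    by (cases k) auto
  have "\<not> 1 / t < lac_node q j"
    using not_less_Least[of j "\<lambda>k. 1 / t < lac_node q k"] j by (simp add: k_def)
  then have tj: "t \<le> lac_node q j powr (-1)"
    using assms lac_node_pos[of q j] by (simp add: powr_minus field_simps)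
  have "t powr (-(p / q)) = (1 / t) powr (p / q)"
    using assms by (simp add: powr_minus powr_divide field_simps)
  also have "\<dots> \<le> lac_node q k powr (p / q)"
    using k assms by (intro powr_mono2) auto
  also have "\<dots> = lac_node q j powr p"
    using assms by (simp add: j lac_node_Suc powr_powr)
  finally have "exp (-1) * t powr (-(p / q)) \<le> exp (-1) * lac_node q j powr p"
    by simp
  also have "\<dots> \<le> lac_sum q p t"
    using assms tj by (intro lac_sum_at_node) auto
  finally show ?thesis .
qed

lemma lac_sum_le_suminf:
  fixes t :: real
  assumes "1 < q" "0 < p" "0 < t" "0 < e"
    and "\<And>k. lac_term q p k t \<le> C * lac_node q k powr (-e)"
  shows "lac_sum q p t \<le> C * (\<Sum>k. lac_node q k powr (-e))"
proof -
  note s = summable_lac_node_powr[OF assms(1,4)]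
  have "lac_sum q p t \<le> (\<Sum>k. C * lac_node q k powr (-e))"
    unfolding lac_sum_def
    using assms s by (intro suminf_le summable_lac_term summable_mult) auto
  also have "\<dots> = C * (\<Sum>k. lac_node q k powr (-e))"
    using s by (rule suminf_mult)
  finally show ?thesis .
qed

text \<open>With \<open>m = e\<close> in \<open>lac_term_le\<close>, the nodes are left with the
  negative exponent \<open>p - e\<close>.\<close>

lemma lac_sum_upper:
  assumes "1 < q" "0 < p" "p < e"
  shows "\<exists>C\<ge>1. \<forall>t>0. lac_sum q p t \<le> C * t powr (-e)"
proof -
  define S where "S = (\<Sum>k. lac_node q k powr (-(e - p)))"
  show ?thesis
  proof (intro exI conjI allI impI)
    fix t :: real assume t: "0 < t"
    have "lac_sum q p t \<le> (e powr e * t powr (-e)) * S"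
      unfolding S_def using assms t lac_term_le[OF t, of e q p]
      by (intro lac_sum_le_suminf) auto
    also have "\<dots> = (e powr e * S) * t powr (-e)"
      by simp
    also have "\<dots> \<le> max 1 (e powr e * S) * t powr (-e)"
      by (intro mult_right_mono) auto
    finally show "lac_sum q p t \<le> max 1 (e powr e * S) * t powr (-e)" .
  qed auto
qed

text \<open>Between two consecutive nodes the sum is as small as its lower order allows: at
  \<open>t = N\<^sub>k powr (-\<theta>)\<close> the terms before \<open>k\<close> contribute about \<open>N\<^sub>k powr (p / q)\<close>, and
  the exponential factor makes the remaining ones bounded since \<open>\<theta> < 1\<close>.\<close>

lemma lac_sum_between_nodes:
  assumes "1 < q" "0 < p" "p / q < e"
  shows "\<exists>C\<ge>1. \<exists>\<theta>>0. \<forall>k. lac_sum q p (lac_node q k powr (-\<theta>))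
           \<le> C * (lac_node q k powr (-\<theta>)) powr (-e)"
proof -
  \<comment> \<open>\<open>\<theta>\<close> is the midpoint of \<open>p / (q * e)\<close> and 1.
    Then \<open>\<epsilon>\<close> is positive and satisfies
    \<open>(p + \<epsilon>) / q = \<theta> * e\<close>, while \<open>m\<close> solves
    \<open>\<theta> * m + p - m = - \<epsilon>\<close>.\<close>
  define \<theta> where "\<theta> = (1 + p / (q * e)) / 2"
  define \<epsilon> where "\<epsilon> = q * \<theta> * e - p"
  define m where "m = (p + \<epsilon>) / (1 - \<theta>)"
  define S where "S = (\<Sum>k. lac_node q k powr (-\<epsilon>))"
  define C where "C = max 1 ((1 + m powr m) * S)"
  have e: "0 < e"
    using assms by (smt (verit) divide_pos_pos)
  have "p / (q * e) < 1"
    using assms e by (simp add: field_simps)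
  then have \<theta>: "0 < \<theta>" "\<theta> < 1"
    using assms e by (auto simp: \<theta>_def add_pos_pos)
  have "\<epsilon> = (q * e - p) / 2"
    using assms e by (simp add: \<epsilon>_def \<theta>_def field_simps)
  then have \<epsilon>: "0 < \<epsilon>"
    using assms by (simp add: field_simps)
  have m: "0 < m"
    using \<theta> \<epsilon> assms by (simp add: m_def)
  have "lac_sum q p (lac_node q k powr (-\<theta>)) \<le> C * (lac_node q k powr (-\<theta>)) powr (-e)" for k
  proof -
    define N where "N = lac_node q"
    define t where "t = N k powr (-\<theta>)"
    have t: "0 < t"
      using lac_node_pos[of q k] by (simp add: t_def N_def)
    have mono: "N i powr x \<le> N j powr x" if "i \<le> j" "0 \<le> x" for i j x
      using that assms unfolding N_def lac_node_powr
      by (auto intro!: mult_left_mono power_increasing)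
    have N1: "1 \<le> N j" for j
      using assms by (simp add: N_def lac_node_def)
    define b where "b = (p + \<epsilon>) / q"
    have b: "0 < b"
      using assms \<epsilon> by (simp add: b_def)
    \<comment> \<open>The factor \<open>N j powr (-\<epsilon>)\<close> secures summability over
      \<open>j\<close>. Before \<open>k\<close>, passing from \<open>N j\<close> to
      \<open>N (Suc j)\<close> divides the exponent by \<open>q\<close>; from \<open>k\<close> on,
      \<open>N k\<close> is replaced by the larger \<open>N j\<close> and the exponents cancel down
      to \<open>- \<epsilon>\<close>.\<close>
    have bound: "lac_term q p j t \<le> (N k powr b + m powr m) * N j powr (-\<epsilon>)" for j
    proof (cases "j < k")
      case True
      have "lac_term q p j t \<le> N j powr p"
        using t lac_node_pos[of q j]
        by (simp add: lac_term_def N_def mult_le_cancel_left1)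
      also have "\<dots> = N j powr (p + \<epsilon>) * N j powr (-\<epsilon>)"
        by (simp flip: powr_add)
      also have "N j powr (p + \<epsilon>) = N (Suc j) powr b"
        using assms by (simp add: N_def lac_node_Suc powr_powr b_def)
      also have "\<dots> \<le> N k powr b"
        using True b by (intro mono) auto
      also have "\<dots> \<le> N k powr b + m powr m"
        by simp
      finally show ?thesis
        by (simp add: mult_right_mono)
    next
      case False
      have "lac_term q p j t \<le> m powr m * t powr (-m) * N j powr (p - m)"
        unfolding N_def using t m by (rule lac_term_le)
      also have "t powr (-m) = N k powr (\<theta> * m)"
        by (simp add: t_def powr_powr)
      also have "m powr m * N k powr (\<theta> * m) * N j powr (p - m)
          \<le> m powr m * N j powr (\<theta> * m) * N j powr (p - m)"
        using False \<theta> m by (intro mult_right_mono mult_left_mono mono) auto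
      also have "\<dots> = m powr m * N j powr (\<theta> * m + (p - m))"
        by (simp add: powr_add)
      also have "\<theta> * m + (p - m) = - \<epsilon>"
      proof -
        have "m * (1 - \<theta>) = p + \<epsilon>"
          using \<theta> by (simp add: m_def)
        then show ?thesis by (simp add: algebra_simps)
      qed
      also have "m powr m * N j powr (-\<epsilon>) \<le> (N k powr b + m powr m) * N j powr (-\<epsilon>)"
        by (intro mult_right_mono) auto
      finally show ?thesis .
    qed
    have S: "0 \<le> S"
      unfolding S_def by (intro suminf_nonneg summable_lac_node_powr assms \<epsilon>) simp
    have "lac_sum q p t \<le> (N k powr b + m powr m) * S"
      unfolding S_def using bound unfolding N_def
      by (intro lac_sum_le_suminf assms t \<epsilon>)
    \<comment> \<open>The bounded contribution of the later terms is absorbed, since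
      \<open>N k powr b\<close> is at least 1.\<close>
    also have "\<dots> \<le> (N k powr b + m powr m * N k powr b) * S"
      using N1[of k] b S
      by (intro mult_right_mono add_left_mono) (auto simp: ge_one_powr_ge_zero mult_le_cancel_left1)
    also have "\<dots> = ((1 + m powr m) * S) * N k powr b"
      by (simp add: algebra_simps)
    also have "\<dots> \<le> C * N k powr b"
      unfolding C_def by (intro mult_right_mono) auto
    also have "N k powr b = t powr (-e)"
      using assms by (simp add: t_def powr_powr b_def \<epsilon>_def)
    finally show ?thesis
      by (simp add: t_def N_def)
  qed
  then show ?thesis
    using \<theta> by (intro exI[of _ C] conjI exI[of _ \<theta>]) (auto simp: C_def)
qed

section \<open>The sum as an analytic function on the right half-plane\<close>

lemma norm_lac_term_le:
  fixes z :: complex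
  assumes "x \<le> Re z"
  shows "norm (lac_term q p k z) \<le> lac_term q p k x"
  using assms lac_node_pos[of q k] by (simp add: lac_term_def norm_mult)

text \<open>Differentiating a term brings down the factor \<open>- lac_node q k\<close>, which
  raises \<open>p\<close> by one. Termwise differentiation is justified by locally uniform
  convergence.\<close>

lemma lac_sum_has_field_derivative:
  fixes z :: complex
  assumes "1 < q" "0 < p" "0 < Re z"
  shows "(lac_sum q p has_field_derivative - lac_sum q (p + 1) z) (at z)"
proof -
  define S where "S = {z. 0 < Re z}"
  have S: "open S"
    unfolding S_def by (rule open_halfspace_Re_gt)
  have der: "(lac_term q p k has_field_derivative - lac_term q (p + 1) k w) (at w)" for k and w :: complex
    unfolding lac_term_def
    using lac_node_pos[of q k]
    by (auto intro!: derivative_eq_intros simp: powr_add)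
  have ex: "\<exists>d h. 0 < d \<and> summable h \<and> range h \<subseteq> \<real>\<^sub>\<ge>\<^sub>0 \<and>
      (\<forall>\<^sub>F n in sequentially. \<forall>y\<in>ball x d \<inter> S. cmod (lac_term q p n y) \<le> cmod (h n))"
    if "x \<in> S" for x
  proof -
    \<comment> \<open>On the ball of radius \<open>Re x / 2\<close> about \<open>x\<close> real
      parts stay above \<open>d\<close>, so the convergent real series at \<open>d\<close> is a
      majorant.\<close>
    define d where "d = Re x / 2"
    have d: "0 < d"
      using that by (simp add: d_def S_def)
    have "cmod (lac_term q p n y) \<le> lac_term q p n d" if "y \<in> ball x d" for n y
    proof (rule norm_lac_term_le)
      have "\<bar>Re x - Re y\<bar> \<le> dist x y"
        using abs_Re_le_cmod[of "x - y"] by (simp add: dist_norm)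
      then show "d \<le> Re y"
        using that unfolding mem_ball d_def by linarith
    qed
    then show ?thesis
      using d summable_lac_term[OF assms(1,2) d] lac_term_nonneg[of q p _ d]
      by (intro exI[of _ d] exI[of _ "\<lambda>n. of_real (lac_term q p n d)"])
         (auto intro!: summable_of_real)
  qed
  obtain g g' where g: "\<And>x. x \<in> S \<Longrightarrow> (\<lambda>n. lac_term q p n x) sums g x"
    "\<And>x. x \<in> S \<Longrightarrow> (\<lambda>n. - lac_term q (p + 1) n x) sums g' x"
    "\<And>x. x \<in> S \<Longrightarrow> (g has_field_derivative g' x) (at x)"
    using series_and_derivative_comparison_complex[OF S, of "lac_term q p"
        "\<lambda>n. \<lambda>x. - lac_term q (p + 1) n x"] der ex
    by blast
  have z: "z \<in> S"
    using assms by (simp add: S_def)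
  have "(lac_sum q p has_field_derivative g' z) (at z)"
    using g(3)[OF z] S z
    by (rule has_field_derivative_transform_within_open)
       (use g(1) in \<open>simp add: lac_sum_def sums_iff\<close>)
  moreover have "g' z = - lac_sum q (p + 1) z"
    using sums_minus[OF g(2)[OF z]] by (simp add: lac_sum_def sums_iff)
  ultimately show ?thesis by simp
qed

lemma lac_sum_of_real:
  assumes "1 < q" "0 < p" "0 < t"
  shows "lac_sum q p (complex_of_real t) = of_real (lac_sum q p t)"
proof -
  have "(\<lambda>k. complex_of_real (lac_term q p k t)) sums of_real (lac_sum q p t)"
    unfolding lac_sum_def
    by (intro sums_of_real summable_sums summable_lac_term assms)
  moreover have "complex_of_real (lac_term q p k t) = lac_term q p k (of_real t)" for k
    by (simp add: lac_term_def flip: exp_of_real)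
  ultimately show ?thesis
    by (simp add: lac_sum_def sums_iff)
qed

lemma norm_lac_sum_le:
  fixes z :: complex
  assumes "1 < q" "0 < p" "0 < t" "t \<le> Re z"
  shows "norm (lac_sum q p z) \<le> lac_sum q p t"
  unfolding lac_sum_def
  using summable_lac_term[OF assms(1-3)] norm_lac_term_le[OF assms(4)]
  by (intro norm_suminf_le) auto

section \<open>The exponential of a lacunary sum\<close>

text \<open>This is log M(r,f) for the function f below. The family is closed under differentiation,
  so one analysis serves both log M and K.\<close>

definition growth_profile :: "real \<Rightarrow> real \<Rightarrow> real \<Rightarrow> real \<Rightarrow> real \<Rightarrow> real" where
  "growth_profile a b q p r = a * (1 - r) powr (-b) + lac_sum q p (1 - r)"

definition lac_exp :: "real \<Rightarrow> real \<Rightarrow> real \<Rightarrow> real \<Rightarrow> complex \<Rightarrow> complex" where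
  "lac_exp a b q p z = exp (of_real a * (1 - z) powr (of_real (-b)) + lac_sum q p (1 - z))"

lemma lac_exp_analytic:
  assumes "1 < q" "0 < p"
  shows "lac_exp a b q p analytic_on ball 0 1"
proof -
  have Re: "0 < Re (1 - z)" if "z \<in> ball 0 1" for z :: complex
    using that complex_Re_le_cmod[of z] by simp
  have "lac_sum q p holomorphic_on {z. 0 < Re z}"
    using lac_sum_has_field_derivative[OF assms] open_halfspace_Re_gt[of 0]
    by (auto simp: holomorphic_on_open)
  moreover have "(\<lambda>z. 1 - z) holomorphic_on ball 0 (1::real)"
    by (intro holomorphic_intros)
  ultimately have "(lac_sum q p \<circ> (\<lambda>z. 1 - z)) holomorphic_on ball 0 1"
    using Re by (intro holomorphic_on_compose_gen[of _ _ "lac_sum q p" "{z. 0 < Re z}"]) auto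
  then have "lac_exp a b q p holomorphic_on ball 0 1"
    unfolding lac_exp_def o_def
    by (intro holomorphic_intros) (use Re in \<open>force simp: complex_nonpos_Reals_iff\<close>)+
  then show ?thesis
    by (simp add: analytic_on_open)
qed

lemma lac_exp_of_real:
  assumes "1 < q" "0 < p" "r < 1"
  shows "lac_exp a b q p (of_real r) = of_real (exp (growth_profile a b q p r))"
proof -
  have "(1 - complex_of_real r) powr (of_real (-b)) = of_real ((1 - r) powr (-b))"
    using assms powr_of_real[of "1 - r" "-b"] by simp
  moreover have "lac_sum q p (1 - complex_of_real r) = of_real (lac_sum q p (1 - r))"
    using lac_sum_of_real[of q p "1 - r"] assms by simp
  ultimately show ?thesis
    by (simp add: lac_exp_def growth_profile_def flip: exp_of_real)
qed

text \<open>The modulus of an exponential is governed by the real part of its exponent, hence by its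
  modulus. Both \<open>Re (1 - z)\<close> and \<open>norm (1 - z)\<close> are at least
  \<open>1 - norm z\<close>, so each summand is largest at the positive point of the circle.\<close>

lemma norm_lac_exp_le:
  assumes "0 \<le> a" "0 \<le> b" "1 < q" "0 < p" "norm z < 1"
  shows "norm (lac_exp a b q p z) \<le> exp (growth_profile a b q p (norm z))"
proof -
  have z: "1 - norm z \<le> Re (1 - z)" "1 - norm z \<le> norm (1 - z)"
    using complex_Re_le_cmod[of z] complex_Re_le_cmod[of "1 - z"] by auto
  have "norm ((1 - z) powr (of_real (-b))) = norm (1 - z) powr (-b)"
    by (simp add: norm_powr_real_powr')
  also have "\<dots> \<le> (1 - norm z) powr (-b)"
    using assms z by (intro powr_mono2') auto
  finally have "norm (of_real a * (1 - z) powr (of_real (-b)) + lac_sum q p (1 - z))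
      \<le> a * (1 - norm z) powr (-b) + lac_sum q p (1 - norm z)"
    using assms z
    by (intro order_trans[OF norm_triangle_ineq] add_mono norm_lac_sum_le)
       (auto simp: norm_mult mult_left_mono)
  then show ?thesis
    unfolding lac_exp_def norm_exp_eq_Re growth_profile_def exp_le_cancel_iff
    by (rule order_trans[OF complex_Re_le_cmod])
qed

lemma max_modulus_lac_exp:
  assumes "0 \<le> a" "0 \<le> b" "1 < q" "0 < p" "0 < r" "r < 1"
  shows "max_modulus r (lac_exp a b q p) = exp (growth_profile a b q p r)"
  unfolding max_modulus_def
proof (rule cSup_eq_maximum)
  show "exp (growth_profile a b q p r) \<in> (\<lambda>z. cmod (lac_exp a b q p z)) ` sphere 0 r"
    using assms by (intro image_eqI[of _ _ "of_real r"]) (auto simp: lac_exp_of_real)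
  show "x \<le> exp (growth_profile a b q p r)"
    if "x \<in> (\<lambda>z. cmod (lac_exp a b q p z)) ` sphere 0 r" for x
    using that assms norm_lac_exp_le[of a b q p] by fastforce
qed

lemma growth_profile_has_derivative:
  assumes "1 < q" "0 < p" "r < 1"
  shows "(growth_profile a b q p has_vector_derivative growth_profile (a * b) (b + 1) q (p + 1) r) (at r)"
proof -
  \<comment> \<open>The real derivative is read off from the complex one, by restriction to the real
    axis and taking real parts.\<close>
  have "((\<lambda>x. lac_sum q p (complex_of_real x)) has_vector_derivative - lac_sum q (p + 1) (of_real (1 - r)))
          (at (1 - r))"
    using assms by (intro has_vector_derivative_real_field lac_sum_has_field_derivative) auto
  then have "((\<lambda>x. Re (lac_sum q p (complex_of_real x))) has_vector_derivative
      Re (- lac_sum q (p + 1) (complex_of_real (1 - r)))) (at (1 - r))"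
    by (rule bounded_linear.has_vector_derivative[OF bounded_linear_Re])
  moreover have "lac_sum q (p + 1) (complex_of_real (1 - r)) = of_real (lac_sum q (p + 1) (1 - r))"
    using assms by (intro lac_sum_of_real) auto
  ultimately have "((\<lambda>x. Re (lac_sum q p (complex_of_real x))) has_real_derivative
      - lac_sum q (p + 1) (1 - r)) (at (1 - r))"
    by (simp add: has_real_derivative_iff_has_vector_derivative)
  then have "(lac_sum q p has_real_derivative - lac_sum q (p + 1) (1 - r)) (at (1 - r))"
    by (rule has_field_derivative_transform_within_open[of _ _ _ "{0<..}"])
       (use assms in \<open>auto simp: lac_sum_of_real\<close>)
  moreover have "((\<lambda>r. 1 - r) has_real_derivative -1) (at r)"
    by (auto intro!: derivative_eq_intros)
  ultimately have 1: "((\<lambda>r. lac_sum q p (1 - r)) has_real_derivative lac_sum q (p + 1) (1 - r)) (at r)"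
    using DERIV_chain2[of "lac_sum q p" "- lac_sum q (p + 1) (1 - r)" "\<lambda>r. 1 - r" r "-1" UNIV] by simp
  have 2: "((\<lambda>r. a * (1 - r) powr (-b)) has_real_derivative a * b * (1 - r) powr (-(b + 1))) (at r)"
    using assms by (auto intro!: derivative_eq_intros simp: powr_diff powr_minus field_simps powr_add)
  show ?thesis
    using DERIV_add[OF 2 1]
    by (simp add: growth_profile_def[abs_def] has_real_derivative_iff_has_vector_derivative)
qed

lemma K_growth_lac_exp:
  assumes "0 \<le> a" "0 \<le> b" "1 < q" "0 < p" "0 < r" "r < 1"
  shows "K_growth r (lac_exp a b q p) = r * growth_profile (a * b) (b + 1) q (p + 1) r"
proof -
  have "((\<lambda>t. ln (max_modulus t (lac_exp a b q p))) has_vector_derivative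
      growth_profile (a * b) (b + 1) q (p + 1) r) (at r)"
    by (rule has_vector_derivative_transform_within_open[OF growth_profile_has_derivative, of _ _ _ "{0<..<1}"])
       (use assms in \<open>auto simp: max_modulus_lac_exp\<close>)
  then have "((\<lambda>t. ln (max_modulus t (lac_exp a b q p))) has_vector_derivative
      growth_profile (a * b) (b + 1) q (p + 1) r) (at_right r)"
    by (rule has_vector_derivative_at_within)
  then show ?thesis
    unfolding K_growth_def by (subst vector_derivative_within) auto
qed

section \<open>Upper and lower orders of the profiles\<close>

lemma growth_profile_pos:
  assumes "0 \<le> a" "1 < q" "0 < p" "r < 1"
  shows "0 < growth_profile a b q p r"
  unfolding growth_profile_def using assms by (intro add_nonneg_pos lac_sum_pos) auto

lemma eventually_at_left_one: "\<forall>\<^sub>F r::real in at_left 1. x < r \<and> r < 1" if "x < 1"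
  using eventually_at_left_real[OF that] by simp

text \<open>The factor between \<open>r\<close> and \<open>1\<close> covers \<open>K(r, f)\<close>, which is \<open>r\<close> times a profile.\<close>

lemma Liminf_growth_profile:
  assumes a: "0 \<le> a" and q: "1 < q" and p: "0 < p"
    and e: "0 < a \<and> p / q \<le> b \<and> e = b \<or> a = 0 \<and> e = p / q"
    and G: "\<And>r. 0 < r \<Longrightarrow> r < 1 \<Longrightarrow> r * growth_profile a b q p r \<le> G r"
      "\<And>r. 0 < r \<Longrightarrow> r < 1 \<Longrightarrow> G r \<le> growth_profile a b q p r"
  shows "Liminf (at_left 1) (growth_ratio G) = ereal e"
proof (rule antisym)
  have pq: "0 < p / q"
    using p q by simp
  show "Liminf (at_left 1) (growth_ratio G) \<le> ereal e"
  proof (rule Liminf_growth_ratio_le)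
    show "0 \<le> e"
      using e pq by auto
    fix e' assume e': "e < e'"
    then have "p / q < e'"
      using e by auto
    then obtain C \<theta> where C: "C \<ge> 1" "\<theta> > 0"
      "\<And>k. lac_sum q p (lac_node q k powr (-\<theta>)) \<le> C * (lac_node q k powr (-\<theta>)) powr (-e')"
      using lac_sum_between_nodes[OF q p] by blast
    define X where "X k = 1 - lac_node q k powr (-\<theta>)" for k
    have X01: "0 < X k" "X k < 1" for k
      using C(2) q by (auto simp: X_def lac_node_powr)
    have lim: "filterlim X (at_left 1) sequentially"
      unfolding X_def using q C(2) by (rule filterlim_one_minus_lac_node_powr)
    have bound: "G (X k) \<le> (a + C) * (1 - X k) powr (-e')" for k
    proof -
      have "a * (1 - X k) powr (-b) \<le> a * (1 - X k) powr (-e')"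
        using e e' X01[of k] by (elim disjE) (auto intro!: mult_left_mono powr_mono')
      moreover have "lac_sum q p (1 - X k) \<le> C * (1 - X k) powr (-e')"
        using C(3)[of k] by (simp add: X_def)
      ultimately show ?thesis
        using G(2)[OF X01[of k]] by (simp add: growth_profile_def algebra_simps)
    qed
    show "\<exists>C\<ge>1. \<exists>\<^sub>F r in at_left 1. G r \<le> C * (1 - r) powr (-e')"
      using frequently_seqI[OF lim, of "\<lambda>r. G r \<le> (a + C) * (1 - r) powr (-e')"] bound a C(1)
      by (intro exI[of _ "a + C"]) auto
  qed
  \<comment> \<open>The constant comes from the power if \<open>a\<close> is positive and from
    \<open>lac_sum_lower\<close> otherwise; the half pays for the factor \<open>r\<close>, which
    exceeds 1/2 near 1.\<close>
  define c where "c = (if 0 < a then a else exp (-1)) / 2"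
  have c: "0 < c"
    by (simp add: c_def)
  have "\<forall>\<^sub>F r in at_left 1. c * (1 - r) powr (-e) \<le> G r"
    using eventually_at_left_one[of "1 / 2", simplified] eventually_at_left_one[of "1 - exp (-1)", simplified]
  proof eventually_elim
    case (elim r)
    have "2 * c * (1 - r) powr (-e) \<le> growth_profile a b q p r"
      using e
    proof
      assume *: "0 < a \<and> p / q \<le> b \<and> e = b"
      have "0 < lac_sum q p (1 - r)"
        using q p elim by (intro lac_sum_pos) auto
      with * show ?thesis
        by (simp add: c_def growth_profile_def)
    next
      assume *: "a = 0 \<and> e = p / q"
      then show ?thesis
        using lac_sum_lower[OF q p, of "1 - r"] elim by (simp add: c_def growth_profile_def)
    qed
    then have "c * (1 - r) powr (-e) \<le> 1 / 2 * growth_profile a b q p r"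
      by simp
    also have "\<dots> \<le> r * growth_profile a b q p r"
      using elim growth_profile_pos[OF a q p, of r b] by (intro mult_right_mono) auto
    also have "\<dots> \<le> G r"
      using elim by (intro G) auto
    finally show ?case .
  qed
  with c show "ereal e \<le> Liminf (at_left 1) (growth_ratio G)"
    by (rule ereal_le_Liminf_growth_ratio)
qed

text \<open>The order \<open>p\<close> is reached at the points where 1 - r is the reciprocal of a
  node; \<open>b \<le> p\<close> keeps the power from exceeding it.\<close>

lemma Limsup_growth_profile:
  assumes a: "0 \<le> a" and q: "1 < q" and p: "0 < p" and b: "b \<le> p"
  shows "Limsup (at_left 1) (growth_ratio (growth_profile a b q p)) = ereal p"
proof (rule antisym)
  show "Limsup (at_left 1) (growth_ratio (growth_profile a b q p)) \<le> ereal p"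
  proof (rule Limsup_growth_ratio_le)
    show "0 \<le> p" using p by simp
    fix e' assume e': "p < e'"
    obtain C where C: "C \<ge> 1" "\<And>t. t > 0 \<Longrightarrow> lac_sum q p t \<le> C * t powr (-e')"
      using lac_sum_upper[OF q p e'] by auto
    have "\<forall>\<^sub>F r in at_left 1. growth_profile a b q p r \<le> (a + C) * (1 - r) powr (-e')"
      using eventually_at_left_one[OF zero_less_one]
    proof eventually_elim
      case (elim r)
      have "a * (1 - r) powr (-b) \<le> a * (1 - r) powr (-e')"
        using a b e' elim by (intro mult_left_mono powr_mono') auto
      then show ?case
        using C(2)[of "1 - r"] elim by (simp add: growth_profile_def algebra_simps)
    qed
    then show "\<exists>C\<ge>1. \<forall>\<^sub>F r in at_left 1. growth_profile a b q p r \<le> C * (1 - r) powr (-e')"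
      using a C(1) by (intro exI[of _ "a + C"]) auto
  qed
  define X where "X k = 1 - lac_node q k powr (-1)" for k
  have X01: "0 < X k" "X k < 1" for k
    using q unfolding X_def lac_node_powr by auto
  have lim: "filterlim X (at_left 1) sequentially"
    unfolding X_def using q zero_less_one by (rule filterlim_one_minus_lac_node_powr)
  have "exp (-1) * (1 - X k) powr (-p) \<le> growth_profile a b q p (X k)" for k
  proof -
    have "exp (-1) * lac_node q k powr p \<le> lac_sum q p (1 - X k)"
      using X01[of k] by (intro lac_sum_at_node q p) (auto simp: X_def)
    moreover have "lac_node q k powr p = (1 - X k) powr (-p)"
      unfolding X_def lac_node_powr by (simp add: powr_def)
    moreover have "0 \<le> a * (1 - X k) powr (-b)"
      using a by simp
    ultimately show ?thesis
      by (simp add: growth_profile_def)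
  qed
  then have "\<exists>\<^sub>F r in at_left 1. exp (-1) * (1 - r) powr (-p) \<le> growth_profile a b q p r"
    by (rule frequently_seqI[OF lim])
  then show "ereal p \<le> Limsup (at_left 1) (growth_ratio (growth_profile a b q p))"
    by (intro ereal_le_Limsup_growth_ratio[of "exp (-1)"]) auto
qed

text \<open>In each pair of alternatives, either the power dominates the lower order of the sum, or
  it is absent and the sum decides. The second pair is the first one for the differentiated
  profile.\<close>

lemma lac_exp_orders:
  assumes a: "0 \<le> a" and b: "0 < b" "b \<le> p" and q: "1 < q" and p: "0 < p"
    and e: "0 < a \<and> p / q \<le> b \<and> e = b \<or> a = 0 \<and> e = p / q"
    and e': "0 < a \<and> (p + 1) / q \<le> b + 1 \<and> e' = b + 1 \<or> a = 0 \<and> e' = (p + 1) / q"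
  shows "lambda_M (lac_exp a b q p) = ereal e" "sigma_M (lac_exp a b q p) = ereal p"
    "lambda_star (lac_exp a b q p) = ereal e'"
proof -
  let ?f = "lac_exp a b q p" and ?P = "growth_profile a b q p"
  have ev: "\<forall>\<^sub>F r in at_left 1. ereal (log_plus (log_plus (max_modulus r ?f)) / ln (1 / (1 - r)))
      = growth_ratio ?P r"
    using eventually_at_left_one[OF zero_less_one]
  proof eventually_elim
    case (elim r)
    \<comment> \<open>As the profile is positive, the inner \<open>log_plus\<close> simply undoes
      the exponential.\<close>
    then have "log_plus (max_modulus r ?f) = ?P r"
      using a b q p growth_profile_pos[OF a q p, of r b]
      by (simp add: max_modulus_lac_exp log_plus_def)
    then show ?case
      by (simp add: growth_ratio_def)
  qed
  have P: "r * ?P r \<le> ?P r" if "0 < r" "r < 1" for r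
    using that growth_profile_pos[OF a q p, of r b] by (simp add: mult_le_cancel_right1)
  show "lambda_M ?f = ereal e"
    unfolding lambda_M_def Liminf_eq[OF ev]
    by (rule Liminf_growth_profile[OF a q p e P order_refl])
  show "sigma_M ?f = ereal p"
    unfolding sigma_M_def Limsup_eq[OF ev] by (intro Limsup_growth_profile a q p b)
  let ?P' = "growth_profile (a * b) (b + 1) q (p + 1)"
  have K: "K_growth r ?f = r * ?P' r" if "0 < r" "r < 1" for r
    using that a b q p by (intro K_growth_lac_exp) auto
  have P': "r * ?P' r \<le> ?P' r" if "0 < r" "r < 1" for r
    using that growth_profile_pos[of "a * b" q "p + 1" r "b + 1"] a b q p
    by (simp add: mult_le_cancel_right1)
  have "Liminf (at_left 1) (growth_ratio (\<lambda>r. K_growth r ?f)) = ereal e'"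
    by (rule Liminf_growth_profile[of "a * b" q "p + 1" "b + 1"])
       (use a b q p e' K P' in auto)
  then show "lambda_star ?f = ereal e'"
    by (simp add: lambda_star_def growth_ratio_def[abs_def])
qed

section \<open>Choice of the parameters for the two assertions\<close>

theorem proposition10:
  fixes l s :: real
  assumes "0 < l" and "0 < s"
  shows "(l \<le> s \<longrightarrow>
            (\<exists>f :: complex \<Rightarrow> complex. f analytic_on ball 0 1 \<and>
               lambda_M f = ereal l \<and> sigma_M f = ereal s \<and>
               lambda_star f = lambda_M f + 1)) \<and>
         (l < s \<longrightarrow>
            (\<exists>f :: complex \<Rightarrow> complex. f analytic_on ball 0 1 \<and>
               lambda_M f = ereal l \<and> sigma_M f = ereal s \<and>
               lambda_star f = lambda_M f + lambda_M f / sigma_M f))"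
proof (intro conjI impI)
  assume "l \<le> s"
  \<comment> \<open>The summand 1 keeps \<open>q\<close> above 1 even when \<open>l = s\<close>, and
    makes both lower orders of the sums at most those of the powers.\<close>
  define q where "q = s / l + 1"
  have q: "1 < q"
    using assms by (simp add: q_def)
  have "s / q \<le> l" "(s + 1) / q \<le> l + 1"
    using assms by (auto simp: q_def field_simps)
  then have "lambda_M (lac_exp 1 l q s) = ereal l" "sigma_M (lac_exp 1 l q s) = ereal s"
    "lambda_star (lac_exp 1 l q s) = ereal (l + 1)"
    using assms \<open>l \<le> s\<close> q by (intro lac_exp_orders; simp)+
  then show "\<exists>f. f analytic_on ball 0 1 \<and> lambda_M f = ereal l \<and> sigma_M f = ereal s \<and>
      lambda_star f = lambda_M f + 1"
    using lac_exp_analytic[OF q assms(2), of 1 l]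
    by (intro exI[of _ "lac_exp 1 l q s"]) (simp add: one_ereal_def)
next
  assume "l < s"
  \<comment> \<open>This is the ratio for which the sum has lower order exactly \<open>l\<close>;
    that of its derivative is then \<open>(s + 1) * l / s\<close>.\<close>
  define q where "q = s / l"
  have q: "1 < q"
    using assms \<open>l < s\<close> by (simp add: q_def)
  have "s / q = l" "(s + 1) / q = l + l / s"
    using assms by (auto simp: q_def field_simps)
  then have "lambda_M (lac_exp 0 l q s) = ereal l" "sigma_M (lac_exp 0 l q s) = ereal s"
    "lambda_star (lac_exp 0 l q s) = ereal (l + l / s)"
    using assms \<open>l < s\<close> q by (intro lac_exp_orders; simp)+
  then show "\<exists>f. f analytic_on ball 0 1 \<and> lambda_M f = ereal l \<and> sigma_M f = ereal s \<and>
      lambda_star f = lambda_M f + lambda_M f / sigma_M f"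
    using lac_exp_analytic[OF q assms(2), of 0 l] assms
    by (intro exI[of _ "lac_exp 0 l q s"]) simp
qed

end
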